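(* There exists an absolute constant $\alpha > 0$ such that for every integer $k \geq 1$ and every subgroup $H$ of $G := \mathrm{Sym}(k)$ of index $|G:H|$ at least $3$, one has $$ |H/H'| \leq |G:H|^{\alpha / \log\log |G:H|}, $$ where $H' := [H,H]$ denotes the commutator subgroup of $H$.
   Context: $\mathrm{Sym}(k)$ denotes the symmetric group on $k$ points. All logarithms are to base $2$. *)

theory Defs
  imports Complex_Main "HOL-Algebra.Algebra"
begin

definition group_index :: "('a, 'b) monoid_scheme \<Rightarrow> 'a set \<Rightarrow> nat"
  where "group_index G H = card (rcosets\<^bsub>G\<^esub> H)"

definition abelianization :: "('a, 'b) monoid_scheme \<Rightarrow> 'a set \<Rightarrow> 'a set monoid"
  where "abelianization G H =
    (G\<lparr>carrier := H\<rparr>) Mod (derived (G\<lparr>carrier := H\<rparr>) H)"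

end

theory Submission
  imports Defs
begin

text \<open>Write \<open>D\<close> for the commutator subgroup of \<open>H\<close> and \<open>n\<close> for the index of \<open>H\<close> in \<open>Sym(k)\<close>. The
  3-cycles that lie in \<open>D\<close> cut the \<open>k\<close> points into \<^emph>\<open>link classes\<close>: two points are linked if some 3-cycle
  in \<open>D\<close> carries one to the other. All 3-cycles supported in one class lie in \<open>D\<close>, and \<open>H\<close> permutes
  the classes because \<open>D\<close> is normal in \<open>H\<close>. The number \<open>m\<close> of classes controls both sides of the
  inequality.

  The abelianization has order at most \<open>4 ^ m\<close> (\<open>order_abelianization_le\<close>). If a group acts on \<open>m\<close>
  points, then an abelian image of it is at most \<open>2 ^ m\<close> times as large as the image of the kernel of
  the action (\<open>card_image_le_fixer\<close>); this is applied to the action of \<open>H\<close> on the classes. An element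
  that fixes every class can be multiplied by 3-cycles from \<open>D\<close> until it moves at most two chosen
  points of each class, so modulo \<open>D\<close> only one bit per class is left (\<open>reduce_to_marked\<close>,
  \<open>card_marked_permutations\<close>), which accounts for another \<open>2 ^ m\<close>.

  The index is at least \<open>k powr (m / 16)\<close> once \<open>m \<ge> 2\<close> and \<open>k\<close> is large (\<open>powr_le_index\<close>). There are
  two sources of cosets. The first is Bochert's argument: if the supports of two permutations meet
  in exactly one point, then their commutator is a 3-cycle. A transversal of the classes supports no
  3-cycle of \<open>D\<close>, hence at least half of it is a set \<open>T\<close> with \<open>H \<inter> Sym(T) = 1\<close>, and the elements of
  \<open>Sym(T)\<close> lie in distinct cosets: \<open>n \<ge> |T|!\<close>. The second: for a class \<open>C\<close>, every set of size \<open>|C|\<close> is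
  the preimage of a class under a coset representative, so that \<open>n * m \<ge> (k choose |C|)\<close>. The first
  bound is good enough for \<open>m ^ 2 > k\<close>; otherwise the largest class has at least \<open>m\<close> points and the
  second bound applies. If there is only one class, then \<open>D\<close> contains all 3-cycles and \<open>n \<le> 2\<close>.

  Finally \<open>n \<le> k!\<close> gives \<open>log log n \<le> 2 * log k\<close>, and hence
  \<open>log |H/D| \<le> 2 * m \<le> 32 * log n / log k \<le> 64 * log n / log log n\<close>. The finitely many small \<open>k\<close> only
  influence the constant.\<close>

section \<open>Abelian images of groups acting on finite sets\<close>

locale abelian_image_action = G?: group G + codomain: comm_group A + group_hom G A f
  for G (structure) and A (structure) and f +
  fixes act :: "'a \<Rightarrow> 'x \<Rightarrow> 'x"
  assumes finite_carrier: "finite (carrier G)"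
    and act_one: "act \<one> x = x"
    and act_mult: "g \<in> carrier G \<Longrightarrow> h \<in> carrier G \<Longrightarrow> act (g \<otimes> h) x = act g (act h x)"
begin

definition fixer :: "'a set \<Rightarrow> 'x set \<Rightarrow> 'a set"
  where "fixer H S = {h \<in> H. \<forall>x\<in>S. act h x = x}"

lemma act_inv: "g \<in> carrier G \<Longrightarrow> act (inv g) (act g x) = x"
  by (metis G.inv_closed G.l_inv act_mult act_one)

lemma subgroup_fixer:
  assumes "subgroup H G"
  shows "subgroup (fixer H S) G"
proof (rule G.subgroupI)
  interpret H: subgroup H G by fact
  show "fixer H S \<subseteq> carrier G" using H.subset by (auto simp: fixer_def)
  have "\<one> \<in> fixer H S" using H.one_closed act_one by (simp add: fixer_def)
  then show "fixer H S \<noteq> {}" by blast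
  show "inv a \<in> fixer H S" if "a \<in> fixer H S" for a
    using that act_inv[of a] H.mem_carrier[of a] by (auto simp: fixer_def) (metis act_inv)
  show "a \<otimes> b \<in> fixer H S" if "a \<in> fixer H S" "b \<in> fixer H S" for a b
    using that act_mult H.mem_carrier by (auto simp: fixer_def)
qed

lemma fixer_fixer: "fixer (fixer H S) Y = fixer H (S \<union> Y)"
  by (auto simp: fixer_def)

definition invariants :: "'a set \<Rightarrow> 'x set \<Rightarrow> ('x \<Rightarrow> 'z) \<Rightarrow> bool"
  where "invariants H S c \<longleftrightarrow>
    subgroup H G \<and> finite S \<and> (\<forall>h\<in>H. \<forall>x\<in>S. act h x \<in> S \<and> c (act h x) = c x)"

text \<open>The induction step for an action with a nontrivial invariant partition: the bound for one part
  and \<open>H\<close> is multiplied with the bound for the other parts and the pointwise fixer of the first.\<close>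

lemma card_image_le_split:
  fixes c :: "'x \<Rightarrow> 'c set"
  assumes IH: "\<And>Y H (c :: 'x \<Rightarrow> 'c set). card Y < card S \<Longrightarrow> invariants H Y c \<Longrightarrow>
      card (f ` H) * 2 ^ card (c ` Y) \<le> 2 ^ card Y * card (f ` fixer H Y)"
    and inv: "invariants H S c" and two: "card (c ` S) \<ge> 2"
  shows "card (f ` H) * 2 ^ card (c ` S) \<le> 2 ^ card S * card (f ` fixer H S)"
proof -
  have fin: "finite S" and H: "subgroup H G" using inv by (auto simp: invariants_def)
  from two obtain x where x: "x \<in> S" by (cases "S = {}") auto
  define Y where "Y = {y \<in> S. c y = c x}"
  define Z where "Z = S - Y"
  have un: "S = Y \<union> Z" "Y \<inter> Z = {}" "finite Y" "finite Z" using fin by (auto simp: Y_def Z_def)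
  have cY: "c ` Y = {c x}" using x by (auto simp: Y_def)
  have cX: "c ` S = insert (c x) (c ` Z)" "c x \<notin> c ` Z" using x by (auto simp: Y_def Z_def)
  have card_cX: "card (c ` S) = Suc (card (c ` Z))" using cX un(4) by simp
  have "Z \<noteq> {}" using two card_cX by auto
  moreover have "Y \<noteq> {}" using x by (auto simp: Y_def)
  ultimately have less: "card Y < card S" "card Z < card S"
    using un by (auto simp: card_Un_disjoint card_gt_0_iff)
  have 1: "card (f ` H) * 2 ^ card (c ` Y) \<le> 2 ^ card Y * card (f ` fixer H Y)"
    using inv by (intro IH less) (auto simp: invariants_def Y_def)
  have 2: "card (f ` fixer H Y) * 2 ^ card (c ` Z) \<le> 2 ^ card Z * card (f ` fixer (fixer H Y) Z)"
  proof (intro IH less)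
    show "invariants (fixer H Y) Z c"
      using inv subgroup_fixer[OF H, of Y] un(4)
      unfolding invariants_def by (auto simp: Y_def Z_def fixer_def)
  qed
  have "card (f ` H) * 2 ^ card (c ` S) = (card (f ` H) * 2 ^ card (c ` Y)) * 2 ^ card (c ` Z)"
    by (simp add: card_cX cY)
  also have "\<dots> \<le> 2 ^ card Y * (card (f ` fixer H Y) * 2 ^ card (c ` Z))"
    using mult_right_mono[OF 1, of "2 ^ card (c ` Z)"] by (simp add: mult.assoc)
  also have "\<dots> \<le> 2 ^ card Y * (2 ^ card Z * card (f ` fixer (fixer H Y) Z))"
    using 2 by simp
  also have "\<dots> = 2 ^ card S * card (f ` fixer H S)"
    using un by (simp add: fixer_fixer card_Un_disjoint power_add)
  finally show ?thesis .
qed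

text \<open>The induction is on the number of points. It needs the factor \<open>2 ^ card (c ` S)\<close>, where \<open>c\<close> is any
  function that is constant on orbits: \<open>c\<close> keeps track of a partition of \<open>S\<close> into invariant parts, and
  each part saves a factor of two. This saving pays for the case of a transitive action. There let
  \<open>H1\<close> be a point stabilizer and let \<open>d\<close> be the index of \<open>f ` H1\<close> in \<open>f ` H\<close>. For \<open>d = 1\<close> the group \<open>H\<close>
  can be replaced by \<open>H1\<close>, which acts on one point less. For \<open>d > 1\<close> the preimage \<open>L\<close> of \<open>f ` H1\<close> has
  index \<open>d\<close> in \<open>H\<close> and splits \<open>S\<close> into \<open>d\<close> invariant parts; the index contributes \<open>d\<close>, the parts save
  \<open>2 ^ d\<close>, and \<open>2 * d \<le> 2 ^ d\<close>.\<close>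

lemma card_image_le_fixer_invariants:
  fixes c :: "'x \<Rightarrow> 'c set"
  assumes "invariants H S c"
  shows "card (f ` H) * 2 ^ card (c ` S) \<le> 2 ^ card S * card (f ` fixer H S)"
  using assms
proof (induction "card S" arbitrary: S H c rule: less_induct)
  case less
  have split: "card (f ` H) * 2 ^ card (c ` S) \<le> 2 ^ card S * card (f ` fixer H S)"
    if "invariants H S c" "card (c ` S) \<ge> 2" for H and c :: "'x \<Rightarrow> 'c set"
    by (rule card_image_le_split[OF _ that]) (rule less.hyps)
  have fin: "finite S" and H: "subgroup H G" 
    and closed: "\<And>h x. h \<in> H \<Longrightarrow> x \<in> S \<Longrightarrow> act h x \<in> S"
    using less.prems by (auto simp: invariants_def)
  interpret H: subgroup H G by fact
  have finH: "finite H" using finite_subset[OF H.subset finite_carrier] .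
  show ?case
  proof (cases "card (c ` S) \<ge> 2")
    case True
    then show ?thesis using split[OF less.prems] by simp
  next
    case few_values: False
    show ?thesis
    proof (cases "S = {}")
      case True
      then show ?thesis by (simp add: fixer_def)
    next
      case False
      then obtain x where x: "x \<in> S" by blast
      define Orb where "Orb = (\<lambda>h. act h x) ` H"
      have Orb_S: "Orb \<subseteq> S" using closed x by (auto simp: Orb_def)
      have x_Orb: "x \<in> Orb" 
        unfolding Orb_def using act_one[of x] H.one_closed by (metis image_eqI)
      have Orb_closed: "act h y \<in> Orb" if hy: "h \<in> H" "y \<in> Orb" for h y
      proof -
        obtain g where g: "g \<in> H" "y = act g x" using hy by (auto simp: Orb_def)
        then have "act h y = act (h \<otimes> g) x" using hy act_mult H.mem_carrier by simp
        moreover have "h \<otimes> g \<in> H" using hy g by simp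
        ultimately show ?thesis unfolding Orb_def by (rule image_eqI)
      qed
      have Orb_iff: "act h y \<in> Orb \<longleftrightarrow> y \<in> Orb" if "h \<in> H" for h y
        using Orb_closed[of h y] Orb_closed[of "inv h" "act h y"] act_inv[of h y] that
        by (auto simp: H.mem_carrier)
      have stabx: "subgroup (fixer H {x}) G" using subgroup_fixer[OF H] .
      define H1 where "H1 = fixer H {x}"
      show ?thesis
      proof (cases "Orb = S")
        case not_transitive: False
        \<comment> \<open>The orbit and its complement are two invariant parts, told apart by two arbitrary distinct values.\<close>
        define c' :: "'x \<Rightarrow> 'c set" where "c' y = (if y \<in> Orb then {} else UNIV)" for y
        have c': "c' ` S = {{}, UNIV}" using not_transitive Orb_S x_Orb by (auto simp: c'_def)
        then have two: "card (c' ` S) = 2" by simp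
        have "invariants H S c'"
          using less.prems Orb_iff by (auto simp: invariants_def c'_def)
        then have "card (f ` H) * 2 ^ 2 \<le> 2 ^ card S * card (f ` fixer H S)"
          using split[of H c'] two by simp
        moreover have "(2::nat) ^ card (c ` S) \<le> 2 ^ 2"
          using few_values by (intro power_increasing) auto
        then have "card (f ` H) * 2 ^ card (c ` S) \<le> card (f ` H) * 2 ^ 2"
          by (rule mult_left_mono) simp
        ultimately show ?thesis by linarith
      next
        case transitive: True
        have 1: "card (c ` S) \<le> 1" using few_values by simp
        have H1H: "H1 \<subseteq> H" by (auto simp: H1_def fixer_def)
        interpret H1: subgroup H1 G using stabx by (simp add: H1_def)
        define B where "B = f ` H"
        define B1 where "B1 = f ` H1"
        have B: "subgroup B A" "subgroup B1 A" "B1 \<subseteq> B"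
          using subgroup_img_is_subgroup H H1.subgroup_axioms H1H by (auto simp: B_def B1_def)
        interpret B: subgroup B A by fact
        interpret B1: subgroup B1 A by fact
        have finB: "finite B" using finH by (simp add: B_def)
        show ?thesis
        proof (cases "B1 = B")
          case True
          let ?Y = "S - {x}"
          have inv: "invariants H1 ?Y (\<lambda>_. {} :: 'c set)"
            unfolding invariants_def
          proof (intro conjI ballI)
            fix h y assume hy: "h \<in> H1" "y \<in> ?Y"
            then have "act h x = x" "h \<in> H" by (auto simp: H1_def fixer_def)
            moreover have "act h y \<noteq> act h x"
              using hy act_inv H1.mem_carrier by (metis DiffE singletonI)
            ultimately show "act h y \<in> S - {x}" using closed hy by auto
          qed (use fin H1.subgroup_axioms in auto)
          have "card ?Y < card S" using x fin by (rule card_Diff1_less[rotated])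
          from less.hyps[OF this inv]
          have "card (f ` H1) * 2 ^ card ((\<lambda>_. {} :: 'c set) ` ?Y) \<le> 2 ^ card ?Y * card (f ` fixer H1 ?Y)" .
          moreover have "card (f ` H1) * 1 \<le> card (f ` H1) * 2 ^ card ((\<lambda>_. {} :: 'c set) ` ?Y)"
            by (intro mult_left_mono) auto
          ultimately have "card (f ` H1) * 1 \<le> 2 ^ card ?Y * card (f ` fixer H1 ?Y)"
            by (rule order_trans[rotated])
          moreover have "fixer H1 ?Y = fixer H S"
            using x by (auto simp: H1_def fixer_fixer insert_absorb)
          moreover have "f ` H1 = B" using True by (simp add: B1_def)
          ultimately have "card B \<le> 2 ^ card ?Y * card (f ` fixer H S)"
            by (simp only: mult_1_right)
          then have "card B * 2 \<le> 2 ^ card S * card (f ` fixer H S)"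
            using card.remove[OF fin x] by simp
          moreover have "card B * 2 ^ card (c ` S) \<le> card B * 2 ^ 1"
            using 1 by (intro mult_left_mono power_increasing) auto
          ultimately show ?thesis unfolding B_def power_one_right by linarith
        next
          case proper: False
          define L where "L = {h \<in> H. f h \<in> B1}"
          have L: "subgroup L G"
          proof (rule G.subgroupI)
            have "\<one> \<in> L" using B1.one_closed by (simp add: L_def)
            then show "L \<noteq> {}" by blast
          qed (use H.mem_carrier in \<open>auto simp: L_def\<close>)
          have fL: "f ` L = B1" using H1H by (auto simp: L_def B1_def)
          have fixL: "fixer L S = fixer H S"
            using x by (auto simp: L_def B1_def H1_def fixer_def)
          \<comment> \<open>The \<open>d\<close> invariant parts are indexed by the cosets of \<open>f ` H1\<close>: the point \<open>act h x\<close> belongs to that of \<open>f h\<close>.\<close>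
          define c' where "c' y = B1 #>\<^bsub>A\<^esub> f (SOME h. h \<in> H \<and> act h x = y)" for y
          have c'_eq: "c' (act h x) = B1 #>\<^bsub>A\<^esub> f h" if h: "h \<in> H" for h
          proof -
            define h' where "h' = (SOME h'. h' \<in> H \<and> act h' x = act h x)"
            have h': "h' \<in> H" "act h' x = act h x"
              using someI[of "\<lambda>h'. h' \<in> H \<and> act h' x = act h x" h] h by (auto simp: h'_def)
            have "inv h \<otimes> h' \<in> H1"
              using h h' act_inv act_mult H.mem_carrier by (simp add: H1_def fixer_def)
            then have "f (inv h \<otimes> h') \<in> B1" by (simp add: B1_def)
            then have "f h' \<otimes>\<^bsub>A\<^esub> inv\<^bsub>A\<^esub> f h \<in> B1"
              using h h' H.mem_carrier by (simp add: codomain.m_comm)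
            then have "f h' \<in> B1 #>\<^bsub>A\<^esub> f h"
              using h h' H.mem_carrier B1.rcos_module[OF codomain.is_group] by simp
            then show ?thesis
              using codomain.repr_independence[of "f h'" B1 "f h"] h H.mem_carrier B(2)
              by (simp add: c'_def h'_def)
          qed
          interpret AB: group "A\<lparr>carrier := B\<rparr>" using codomain.subgroup_imp_group B(1) .
          have B1_sub: "subgroup B1 (A\<lparr>carrier := B\<rparr>)"
            using codomain.subgroup_incl B by blast
          have c'_img: "c' ` S = rcosets\<^bsub>A\<lparr>carrier := B\<rparr>\<^esub> B1"
            using c'_eq by (auto simp: transitive[symmetric] Orb_def RCOSETS_def B_def image_image)
          define d where "d = card (c' ` S)"
          have d: "d * card B1 = card B"
            using AB.lagrange[OF B1_sub] by (simp add: d_def c'_img order_def)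
          have cardB: "card B > 0" using finB B.one_closed card_gt_0_iff by blast
          have "d \<noteq> 1" using d proper card_subset_eq[OF finB B(3)] by auto
          moreover have "d \<noteq> 0" using d cardB by (intro notI) simp
          ultimately have d2: "d \<ge> 2" by linarith
          have "invariants L S c'"
            unfolding invariants_def
          proof (intro conjI ballI)
            fix l y assume l: "l \<in> L" and y: "y \<in> S"
            then show "act l y \<in> S" using closed by (auto simp: L_def)
            obtain h where h: "h \<in> H" "y = act h x" using y transitive by (auto simp: Orb_def)
            have lH: "l \<in> H" "f l \<in> B1" using l by (auto simp: L_def)
            have "c' (act l y) = c' (act (l \<otimes> h) x)"
              using lH h act_mult H.mem_carrier by simp
            also have "\<dots> = B1 #>\<^bsub>A\<^esub> (f l \<otimes>\<^bsub>A\<^esub> f h)"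
              using c'_eq lH h H.mem_carrier by simp
            also have "\<dots> = (B1 #>\<^bsub>A\<^esub> f l) #>\<^bsub>A\<^esub> f h"
              using lH h H.mem_carrier B1.subset by (simp add: codomain.coset_mult_assoc)
            also have "\<dots> = c' y"
              using B1.rcos_const[OF codomain.is_group lH(2)] c'_eq h by simp
            finally show "c' (act l y) = c' y" .
          qed (use L fin in auto)
          then have "card B1 * 2 ^ d \<le> 2 ^ card S * card (f ` fixer H S)"
            using split[of L c'] d2 by (simp add: fL fixL d_def)
          moreover have "card B * 2 \<le> card B1 * 2 ^ d"
          proof -
            have "d * 2 \<le> 2 ^ d"
              using d2 by (induction d rule: dec_induct) auto
            then show ?thesis using d by (metis mult.assoc mult.commute mult_le_mono2)
          qed
          moreover have "card B * 2 ^ card (c ` S) \<le> card B * 2 ^ 1"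
            using 1 by (intro mult_left_mono power_increasing) auto
          ultimately show ?thesis unfolding B_def power_one_right by linarith
        qed
      qed
    qed
  qed
qed

corollary card_image_le_fixer:
  assumes H: "subgroup H G" "finite S" "\<And>h x. h \<in> H \<Longrightarrow> x \<in> S \<Longrightarrow> act h x \<in> S"
  shows "card (f ` H) \<le> 2 ^ card S * card (f ` fixer H S)"
proof -
  have "invariants H S (\<lambda>_. {} :: 'c set)"
    using assms by (auto simp: invariants_def)
  from card_image_le_fixer_invariants[OF this]
  have "card (f ` H) * 2 ^ card ((\<lambda>_. {} :: 'c set) ` S) \<le> 2 ^ card S * card (f ` fixer H S)" .
  moreover have "card (f ` H) * 1 \<le> card (f ` H) * 2 ^ card ((\<lambda>_. {} :: 'c set) ` S)"
    by (intro mult_left_mono) auto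
  ultimately show ?thesis by linarith
qed

end

section \<open>Three-cycles and the linked relation\<close>

definition cycle3 :: "'a \<Rightarrow> 'a \<Rightarrow> 'a \<Rightarrow> 'a \<Rightarrow> 'a"
  where "cycle3 a b c = Transposition.transpose a b \<circ> Transposition.transpose b c"

lemma cycle3_apply:
  assumes "distinct [a, b, c]"
  shows "cycle3 a b c x = (if x = a then b else if x = b then c else if x = c then a else x)"
  using assms by (auto simp: cycle3_def Transposition.transpose_def)

lemma cycle3_rotate: "distinct [a, b, c] \<Longrightarrow> cycle3 b c a = cycle3 a b c"
  by (rule ext) (auto simp: cycle3_apply)

lemma inv_cycle3:
  assumes "distinct [a, b, c]"
  shows "inv' (cycle3 a b c) = cycle3 a c b"
proof (rule inv_unique_comp)
  have "distinct [a, c, b]" using assms by auto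
  note c3 = cycle3_apply[OF assms] cycle3_apply[OF this]
  show "cycle3 a b c \<circ> cycle3 a c b = id" "cycle3 a c b \<circ> cycle3 a b c = id"
    by (rule ext, use assms in \<open>auto simp: c3\<close>)+
qed

lemma cycle3_conjugate:
  assumes "bij g" "distinct [a, b, c]"
  shows "g \<circ> cycle3 a b c \<circ> inv' g = cycle3 (g a) (g b) (g c)"
proof -
  have d: "distinct [g a, g b, g c]" using assms by (auto simp: bij_def inj_eq)
  show ?thesis
  proof
    fix x
    obtain y where y: "x = g y" using assms(1) by (metis bij_pointE)
    have "inv' g x = y" using assms(1) y by (simp add: bij_is_inj)
    moreover have "g u = g v \<longleftrightarrow> u = v" for u v using assms(1) by (simp add: bij_is_inj inj_eq)
    ultimately show "(g \<circ> cycle3 a b c \<circ> inv' g) x = cycle3 (g a) (g b) (g c) x"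
      using assms(2) d y by (simp add: cycle3_apply)
  qed
qed

text \<open>Away from \<open>c\<close>, each of the two permutations fixes whatever the other one moves. The commutator can
  therefore move no points but \<open>c\<close> and its two images.\<close>

lemma commutator_eq_cycle3:
  assumes x: "bij x" and y: "bij y" and "x c \<noteq> c" "y c \<noteq> c"
    and meet: "\<And>z. x z \<noteq> z \<Longrightarrow> y z \<noteq> z \<Longrightarrow> z = c"
  shows "x \<circ> y \<circ> inv' x \<circ> inv' y = cycle3 c (x c) (y c)" "distinct [c, x c, y c]"
proof -
  have xe: "x u = x v \<longleftrightarrow> u = v" and ye: "y u = y v \<longleftrightarrow> u = v" for u v
    using x y by (simp_all add: bij_is_inj inj_eq)
  have x_yc: "x (y c) = y c" using meet[of "y c"] assms(4) ye by auto
  have y_xc: "y (x c) = x c" using meet[of "x c"] assms(3) xe by auto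
  show d: "distinct [c, x c, y c]"
    using assms(3,4) x_yc xe[of "x c" c] by auto
  have moved: "x (x u) = x u \<longleftrightarrow> x u = u" "y (y u) = y u \<longleftrightarrow> y u = u" for u
    using xe ye by auto
  have eq: "x (y u) = cycle3 c (x c) (y c) (y (x u))" for u
  proof (cases "x u = u \<or> u = c")
    case True
    consider "u = c" | "u \<noteq> c" "x u = u" "y u = u" | "u \<noteq> c" "x u = u" "y u \<noteq> u" using True by blast
    then show ?thesis
    proof cases
      case 1
      then show ?thesis using d x_yc y_xc by (auto simp: cycle3_apply)
    next
      case 2
      then have "u \<noteq> x c" "u \<noteq> y c" using moved assms(3,4) by auto
      then show ?thesis using 2 d by (simp add: cycle3_apply)
    next
      case 3
      then have "y u \<noteq> x c" "y u \<noteq> y c" using moved[of c] moved[of u] assms(4) y_xc 3 ye[of u "x c"] ye[of u c] by auto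
      moreover have "x (y u) = y u" if "y u \<noteq> c" using meet[of "y u"] moved 3 that by auto
      ultimately show ?thesis using 3 d by (auto simp: cycle3_apply)
    qed
  next
    case False
    then have yu: "y u = u" using meet by blast
    have "x u \<noteq> x c" "x u \<noteq> y c" using False x_yc xe[of u c] xe[of u "y c"] by auto
    moreover have "x u = c \<or> y (x u) = x u" using meet[of "x u"] moved False by auto
    ultimately show ?thesis using yu d by (auto simp: cycle3_apply)
  qed
  show "x \<circ> y \<circ> inv' x \<circ> inv' y = cycle3 c (x c) (y c)"
  proof
    fix v
    have "x (inv' x w) = w" "y (inv' y w) = w" for w
      using x y by (simp_all add: bij_is_surj surj_f_inv_f)
    then show "(x \<circ> y \<circ> inv' x \<circ> inv' y) v = cycle3 c (x c) (y c) v"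
      using eq[of "inv' x (inv' y v)"] by simp
  qed
qed

text \<open>A finite permutation group is given by its set of permutations, so that a group and its
  commutator subgroup can be compared as sets.\<close>

locale perm_group =
  fixes \<Omega> :: "'a set" and D :: "('a \<Rightarrow> 'a) set"
  assumes finite_points: "finite \<Omega>"
    and permutes: "d \<in> D \<Longrightarrow> d permutes \<Omega>"
    and id_closed: "id \<in> D"
    and comp_closed: "d \<in> D \<Longrightarrow> e \<in> D \<Longrightarrow> d \<circ> e \<in> D"
    and inv_closed: "d \<in> D \<Longrightarrow> inv' d \<in> D"
begin

lemma bij: "d \<in> D \<Longrightarrow> bij d"
  using permutes permutes_bij by blast

definition has_cycle3 :: "'a \<Rightarrow> 'a \<Rightarrow> 'a \<Rightarrow> bool"
  where "has_cycle3 a b c \<longleftrightarrow> distinct [a, b, c] \<and> cycle3 a b c \<in> D"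

definition linked :: "'a \<Rightarrow> 'a \<Rightarrow> bool"
  where "linked a b \<longleftrightarrow> a = b \<or> (\<exists>c. has_cycle3 a b c)"

lemma has_cycle3_rotate: "has_cycle3 a b c \<Longrightarrow> has_cycle3 b c a"
  using cycle3_rotate[of a b c] by (simp add: has_cycle3_def) blast

lemma has_cycle3_reverse: "has_cycle3 a b c \<Longrightarrow> has_cycle3 a c b"
  using inv_closed[of "cycle3 a b c"] inv_cycle3[of a b c] by (auto simp: has_cycle3_def)

lemma has_cycle3_perm:
  assumes "has_cycle3 a b c"
  shows "has_cycle3 a c b" "has_cycle3 b a c" "has_cycle3 b c a" "has_cycle3 c a b" "has_cycle3 c b a"
proof -
  show 1: "has_cycle3 a c b" and 2: "has_cycle3 b c a"
    using assms by (fact has_cycle3_reverse, fact has_cycle3_rotate)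
  show "has_cycle3 b a c" "has_cycle3 c a b" "has_cycle3 c b a"
    by (fact has_cycle3_reverse[OF 2] has_cycle3_rotate[OF 2] has_cycle3_rotate[OF 1])+
qed

lemma has_cycle3_conjugate:
  assumes "bij g" and "g \<circ> cycle3 a b c \<circ> inv' g \<in> D" and "has_cycle3 a b c"
  shows "has_cycle3 (g a) (g b) (g c)"
proof -
  have "distinct [a, b, c]" using assms(3) by (simp add: has_cycle3_def)
  then have "distinct [g a, g b, g c]" using assms(1) by (auto simp: bij_def inj_eq)
  then show ?thesis
    using assms(2) cycle3_conjugate[OF assms(1) \<open>distinct [a, b, c]\<close>] by (simp add: has_cycle3_def)
qed

lemma has_cycle3_image:
  assumes "has_cycle3 a b c" and "has_cycle3 u v w"
  shows "has_cycle3 (cycle3 u v w a) (cycle3 u v w b) (cycle3 u v w c)"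
proof -
  have "cycle3 u v w \<in> D" "cycle3 a b c \<in> D" using assms by (simp_all add: has_cycle3_def)
  then show ?thesis
    by (intro has_cycle3_conjugate[OF bij _ assms(1)] comp_closed inv_closed)
qed

text \<open>The 3-cycles on \<open>{a, b, x}\<close> and \<open>{a, c, x}\<close> generate the alternating group on four points;
  conjugating the first by the second produces the required one.\<close>

lemma has_cycle3_exchange:
  assumes "has_cycle3 a b x" and "has_cycle3 a c x" and "b \<noteq> c"
  shows "has_cycle3 a b c"
proof -
  have d: "distinct [a, c, x]" "distinct [a, b, x]" using assms by (auto simp: has_cycle3_def)
  have "cycle3 a c x a = c" "cycle3 a c x b = b" "cycle3 a c x x = a"
    using d assms(3) by (auto simp: cycle3_apply[OF d(1)])
  then have "has_cycle3 c b a"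
    using has_cycle3_image[OF assms(1) assms(2)] by simp
  then show ?thesis by (rule has_cycle3_perm)
qed

lemma linked_sym:
  assumes "linked a b"
  shows "linked b a"
proof (cases "a = b")
  case False
  then obtain c where "has_cycle3 a b c" using assms unfolding linked_def by blast
  then have "has_cycle3 b a c" by (rule has_cycle3_perm)
  then show ?thesis unfolding linked_def by blast
qed (simp add: linked_def)

text \<open>This is why a link class carries its full alternating group: linkedness of two points only
  provides a 3-cycle with an uncontrolled third point, and conjugation moves that point to any
  other place in the class.\<close>

lemma has_cycle3_if_linked:
  assumes "linked a b" "linked a c" "distinct [a, b, c]"
  shows "has_cycle3 a b c"
proof -
  have "a \<noteq> b" "a \<noteq> c" using assms(3) by simp_all
  then obtain x y where x: "has_cycle3 a b x" and y: "has_cycle3 a c y"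
    using assms(1,2) unfolding linked_def by blast
  consider "x = c" | "y = b" | "x = y" | "x \<noteq> c" "y \<noteq> b" "x \<noteq> y" by blast
  then show ?thesis
  proof cases
    case 3
    then show ?thesis using has_cycle3_exchange[of a b x c] x y assms(3) by simp
  next
    case 4
    have d: "distinct [a, b, x]" "distinct [a, c, y]" using x y by (auto simp: has_cycle3_def)
    \<comment> \<open>Conjugation by the second 3-cycle replaces \<open>a\<close> by \<open>c\<close> in the first, which reduces to two 3-cycles that share two points.\<close>
    have "cycle3 a c y a = c" "cycle3 a c y b = b" "cycle3 a c y x = x"
      using d 4 assms(3) by (auto simp: cycle3_apply[OF d(2)])
    then have "has_cycle3 c b x"
      using has_cycle3_image[OF x y] by simp
    then have "has_cycle3 b a c"
      using has_cycle3_exchange[of b a x c, OF has_cycle3_perm(2)[OF x] has_cycle3_perm(2)] assms(3)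
      by simp
    then show ?thesis by (rule has_cycle3_perm)
  qed (use x has_cycle3_perm(1)[OF y] in simp_all)
qed

lemma linked_trans:
  assumes ab: "linked a b" and bc: "linked b c"
  shows "linked a c"
proof -
  consider "a = b" | "b = c" | "a = c" | "distinct [a, b, c]" by auto
  then show ?thesis
  proof cases
    case 4
    then have "has_cycle3 b a c" by (intro has_cycle3_if_linked[OF linked_sym[OF ab] bc]) auto
    then have "has_cycle3 a c b" by (rule has_cycle3_perm(3))
    then show ?thesis unfolding linked_def by blast
  qed (use ab bc in \<open>simp_all add: linked_def\<close>)
qed

end

section \<open>Link classes of a permutation group\<close>

context perm_group
begin

lemma linked_cycle3:
  assumes "has_cycle3 a b c"
  shows "linked x (cycle3 a b c x)"
proof -
  have d: "distinct [a, b, c]" using assms by (simp add: has_cycle3_def)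
  show ?thesis
    using assms has_cycle3_rotate[OF assms] has_cycle3_rotate[OF has_cycle3_rotate[OF assms]]
    unfolding cycle3_apply[OF d] linked_def by auto
qed

definition link_class :: "'a \<Rightarrow> 'a set"
  where "link_class a = {b \<in> \<Omega>. linked a b}"

definition link_classes :: "'a set set"
  where "link_classes = link_class ` \<Omega>"

lemma finite_link_classes: "finite link_classes"
  by (simp add: link_classes_def finite_points)

lemma link_class_self: "a \<in> \<Omega> \<Longrightarrow> a \<in> link_class a"
  by (simp add: link_class_def linked_def)

lemma link_class_eq:
  assumes "C \<in> link_classes" "a \<in> C"
  shows "C = link_class a" and "a \<in> \<Omega>"
proof -
  obtain b where b: "C = link_class b" using assms(1) by (auto simp: link_classes_def)
  then have "linked b a" using assms(2) by (simp add: link_class_def)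
  then have "linked b x \<longleftrightarrow> linked a x" for x using linked_trans linked_sym by metis
  then show "C = link_class a" using b by (simp add: link_class_def)
  show "a \<in> \<Omega>" using assms(2) b by (simp add: link_class_def)
qed

lemma mem_link_class_iff:
  assumes "C \<in> link_classes" "a \<in> C" "b \<in> \<Omega>"
  shows "b \<in> C \<longleftrightarrow> linked a b"
  using link_class_eq[OF assms(1,2)] assms(3) by (simp add: link_class_def)

lemma link_class_mem: "a \<in> \<Omega> \<Longrightarrow> link_class a \<in> link_classes"
  by (simp add: link_classes_def)

text \<open>Two points are singled out in every class, distinct ones whenever the class has more than one
  point.\<close>

definition two_points :: "('a set \<Rightarrow> 'a) \<Rightarrow> ('a set \<Rightarrow> 'a) \<Rightarrow> bool"
  where "two_points p q \<longleftrightarrow> 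
    (\<forall>C\<in>link_classes. p C \<in> C \<and> q C \<in> C \<and> (p C = q C \<longrightarrow> C = {p C}))"

lemma ex_two_points: "\<exists>p q. two_points p q"
proof -
  have "\<exists>p q. p \<in> C \<and> q \<in> C \<and> (p = q \<longrightarrow> C = {p})" if C: "C \<in> link_classes" for C
  proof -
    obtain a where "a \<in> C" using C link_class_self by (auto simp: link_classes_def)
    then show ?thesis by (cases "C = {a}") auto
  qed
  then show ?thesis unfolding two_points_def by metis
qed

definition class_permutations :: "('a \<Rightarrow> 'a) set"
  where "class_permutations = {g. g permutes \<Omega> \<and> (\<forall>x\<in>\<Omega>. linked x (g x))}"

definition marked :: "('a set \<Rightarrow> 'a) \<Rightarrow> ('a set \<Rightarrow> 'a) \<Rightarrow> 'a set"
  where "marked p q = p ` link_classes \<union> q ` link_classes"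

lemma marked_iff:
  assumes "two_points p q" "C \<in> link_classes" "x \<in> C"
  shows "x \<in> marked p q \<longleftrightarrow> x = p C \<or> x = q C"
proof
  assume "x \<in> marked p q"
  then obtain C' where C': "C' \<in> link_classes" "x = p C' \<or> x = q C'" by (auto simp: marked_def)
  then have "x \<in> C'" using assms(1) by (auto simp: two_points_def)
  then have "C' = C" using link_class_eq C'(1) assms(2,3) by metis
  then show "x = p C \<or> x = q C" using C' by simp
qed (use assms(2) in \<open>auto simp: marked_def\<close>)

text \<open>A permutation that preserves the classes can be straightened one point at a time: if \<open>a\<close> is unmarked
  and is sent to \<open>b \<noteq> a\<close>, the 3-cycle \<open>b \<mapsto> a \<mapsto> x \<mapsto> b\<close> restores \<open>a\<close>. Two marked points per
  class are what this takes: one of them differs from \<open>b\<close>, and choosing it as \<open>x\<close> disturbs no unmarked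
  point that has already been restored.\<close>

lemma reduce_to_marked:
  assumes pq: "two_points p q" and "g \<in> class_permutations"
  shows "\<exists>d\<in>D. d \<circ> g \<in> class_permutations \<and> (\<forall>x\<in>\<Omega> - marked p q. (d \<circ> g) x = x)"
  using assms(2)
proof (induction "card {x \<in> \<Omega> - marked p q. g x \<noteq> x}" arbitrary: g rule: less_induct)
  case less
  show ?case
  proof (cases "\<forall>x\<in>\<Omega> - marked p q. g x = x")
    case True
    then show ?thesis using id_closed less.prems by (intro bexI[of _ id]) auto
  next
    case False
    then obtain a where a: "a \<in> \<Omega>" "a \<notin> marked p q" "g a \<noteq> a" by blast
    define b where "b = g a"
    have g: "g permutes \<Omega>" and linked_g: "\<And>x. x \<in> \<Omega> \<Longrightarrow> linked x (g x)"
      using less.prems by (auto simp: class_permutations_def)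
    have b: "b \<in> \<Omega>" "linked a b" using a g linked_g by (auto simp: b_def permutes_in_image)
    define C where "C = link_class a"
    have C: "C \<in> link_classes" "a \<in> C" using a link_class_self by (auto simp: C_def link_class_mem)
    have pqC: "p C \<in> C" "q C \<in> C" "p C = q C \<longrightarrow> C = {p C}"
      using pq C by (auto simp: two_points_def)
    have "a \<noteq> p C" "a \<noteq> q C" using a marked_iff[OF pq C] by auto
    then obtain x where x: "x \<in> C" "x \<in> marked p q" "x \<noteq> b" "x \<noteq> a"
      using pqC C marked_iff[OF pq C(1)] by (metis singletonD)
    then have "x \<in> \<Omega>" "linked a x" using link_class_eq(2)[OF C(1)] mem_link_class_iff[OF C] by auto
    then have cyc: "has_cycle3 b a x"
      using x a(3) by (intro has_cycle3_perm(2)[OF has_cycle3_if_linked[OF b(2)]]) (auto simp: b_def)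
    then have d: "distinct [b, a, x]" and in_D: "cycle3 b a x \<in> D" by (auto simp: has_cycle3_def)
    define g' where "g' = cycle3 b a x \<circ> g"
    have g': "g' \<in> class_permutations"
      using permutes_compose[OF g permutes[OF in_D]] linked_trans[OF linked_g linked_cycle3[OF cyc]]
      by (auto simp: class_permutations_def g'_def)
    have "{y \<in> \<Omega> - marked p q. g' y \<noteq> y} \<subset> {y \<in> \<Omega> - marked p q. g y \<noteq> y}"
    proof (rule psubsetI)
      have "g y \<noteq> y" if "y \<in> \<Omega>" "y \<notin> marked p q" "g' y \<noteq> y" for y
      proof
        assume "g y = y"
        then have "y \<in> {b, a, x}" using that(3) by (auto simp: g'_def cycle3_apply[OF d] split: if_splits)
        moreover have "g b \<noteq> b" using a(3) permutes_inj[OF g] by (auto simp: b_def inj_eq)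
        ultimately show False using \<open>g y = y\<close> a x that by auto
      qed
      then show "{y \<in> \<Omega> - marked p q. g' y \<noteq> y} \<subseteq> {y \<in> \<Omega> - marked p q. g y \<noteq> y}" by blast
      have "g' a = a" by (simp add: g'_def cycle3_apply[OF d] flip: b_def)
      then have "a \<in> {y \<in> \<Omega> - marked p q. g y \<noteq> y}" "a \<notin> {y \<in> \<Omega> - marked p q. g' y \<noteq> y}"
        using a by auto
      then show "{y \<in> \<Omega> - marked p q. g' y \<noteq> y} \<noteq> {y \<in> \<Omega> - marked p q. g y \<noteq> y}" by blast
    qed
    then have "card {y \<in> \<Omega> - marked p q. g' y \<noteq> y} < card {y \<in> \<Omega> - marked p q. g y \<noteq> y}"
      using finite_points by (intro psubset_card_mono) auto
    from less.hyps[OF this g'] obtain d where d: "d \<in> D" "d \<circ> g' \<in> class_permutations"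
        "\<forall>x\<in>\<Omega> - marked p q. (d \<circ> g') x = x" by blast
    then show ?thesis using comp_closed[OF d(1) in_D] 
      by (intro bexI[of _ "d \<circ> cycle3 b a x"]) (simp_all add: g'_def comp_assoc)
  qed
qed

definition marked_permutations :: "('a set \<Rightarrow> 'a) \<Rightarrow> ('a set \<Rightarrow> 'a) \<Rightarrow> ('a \<Rightarrow> 'a) set"
  where "marked_permutations p q = {e \<in> class_permutations. \<forall>x\<in>\<Omega> - marked p q. e x = x}"

text \<open>Since it fixes all other points of the class, such a permutation either fixes the two marked points
  of a class or swaps them.\<close>

lemma marked_permutation_apply:
  assumes pq: "two_points p q" and e: "e \<in> marked_permutations p q" and C: "C \<in> link_classes"
  shows "e (p C) = (if e (p C) = p C then p C else q C)" (is ?p)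
    and "e (q C) = (if e (p C) = p C then q C else p C)" (is ?q)
proof -
  have eperm: "e permutes \<Omega>" and linked_e: "\<And>x. x \<in> \<Omega> \<Longrightarrow> linked x (e x)"
    and fixed: "\<And>x. x \<in> \<Omega> \<Longrightarrow> x \<notin> marked p q \<Longrightarrow> e x = x"
    using e by (auto simp: marked_permutations_def class_permutations_def)
  have inj: "e x = e y \<longleftrightarrow> x = y" for x y using permutes_inj[OF eperm] by (simp add: inj_eq)
  have pqC: "p C \<in> C" "q C \<in> C" using pq C by (auto simp: two_points_def)
  have mem: "e x \<in> {p C, q C}" if x: "x \<in> {p C, q C}" for x
  proof (rule ccontr)
    assume not: "e x \<notin> {p C, q C}"
    have "x \<in> C" using x pqC by auto
    then have "x \<in> \<Omega>" using link_class_eq[OF C] by blast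
    then have "e x \<in> \<Omega>" using permutes_in_image[OF eperm] by simp
    then have "e x \<in> C" using mem_link_class_iff[OF C \<open>x \<in> C\<close>] linked_e \<open>x \<in> \<Omega>\<close> by blast
    then have "e (e x) = e x" using marked_iff[OF pq C] not fixed \<open>e x \<in> \<Omega>\<close> by auto
    then show False using inj not x by auto
  qed
  show ?p using mem[of "p C"] by auto
  show ?q using mem[of "p C"] mem[of "q C"] inj[of "p C" "q C"] by auto
qed

lemma card_marked_permutations:
  assumes pq: "two_points p q"
  shows "card (marked_permutations p q) \<le> 2 ^ card link_classes"
    and "finite (marked_permutations p q)"
proof -
  define S where "S e = {C \<in> link_classes. e (p C) \<noteq> p C}" for e
  have "inj_on S (marked_permutations p q)"
  proof (rule inj_onI, rule ext)
    fix e e' x assume e: "e \<in> marked_permutations p q" "e' \<in> marked_permutations p q" and S: "S e = S e'"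
    show "e x = e' x"
    proof (cases "x \<in> \<Omega> \<and> x \<in> marked p q")
      case False
      then have fixed: "u x = x" if "u \<in> marked_permutations p q" for u
        using that permutes_not_in[of u \<Omega> x]
        by (cases "x \<in> \<Omega>") (auto simp: marked_permutations_def class_permutations_def)
      then show ?thesis using fixed[OF e(1)] fixed[OF e(2)] by simp
    next
      case True
      then obtain C where C: "C \<in> link_classes" "x = p C \<or> x = q C" by (auto simp: marked_def)
      have "e (p C) = p C \<longleftrightarrow> e' (p C) = p C" using S C(1) by (auto simp: S_def)
      then show ?thesis
        using C(2) marked_permutation_apply[OF pq e(1) C(1)] marked_permutation_apply[OF pq e(2) C(1)]
        by metis
    qed
  qed
  moreover have "S ` marked_permutations p q \<subseteq> Pow link_classes" by (auto simp: S_def)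
  ultimately show "card (marked_permutations p q) \<le> 2 ^ card link_classes"
      "finite (marked_permutations p q)"
    using card_inj_on_le[of S _ "Pow link_classes"] inj_on_finite[of S _ "Pow link_classes"]
    by (simp_all add: finite_link_classes card_Pow)
qed

end

text \<open>The set \<open>D\<close> stands for the commutator subgroup of \<open>H\<close>; it may be any group between the commutator
  subgroup and \<open>H\<close>.\<close>

locale perm_group_commutators = perm_group \<Omega> D for \<Omega> :: "'a set" and D +
  fixes H :: "('a \<Rightarrow> 'a) set"
  assumes H_group: "perm_group \<Omega> H"
    and D_subset: "D \<subseteq> H"
    and commutator_mem: "x \<in> H \<Longrightarrow> y \<in> H \<Longrightarrow> x \<circ> y \<circ> inv' x \<circ> inv' y \<in> D"
begin

interpretation H: perm_group \<Omega> H by (fact H_group)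

text \<open>A conjugate of a 3-cycle \<open>d\<close> by \<open>h\<close> is the product of a commutator and \<open>d\<close> itself, so it stays in \<open>D\<close>.\<close>

lemma linked_image:
  assumes h: "h \<in> H" and "linked a b"
  shows "linked (h a) (h b)"
proof (cases "a = b")
  case False
  then obtain c where c: "has_cycle3 a b c" using assms(2) unfolding linked_def by blast
  let ?d = "cycle3 a b c"
  have d: "?d \<in> D" using c by (simp add: has_cycle3_def)
  then have "(h \<circ> ?d \<circ> inv' h \<circ> inv' ?d) \<circ> ?d \<in> D"
    using D_subset by (intro comp_closed commutator_mem h) auto
  moreover have "inv' ?d \<circ> ?d = id" using bij[OF d] by (simp add: bij_is_inj)
  ultimately have "h \<circ> ?d \<circ> inv' h \<in> D" by (simp add: comp_assoc)
  then have "has_cycle3 (h a) (h b) (h c)" using has_cycle3_conjugate[OF H.bij[OF h] _ c] by blast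
  then show ?thesis unfolding linked_def by blast
qed (simp add: linked_def)

lemma image_link_class:
  assumes h: "h \<in> H" and C: "C \<in> link_classes"
  shows "h ` C \<in> link_classes"
proof -
  obtain a where a: "a \<in> \<Omega>" "C = link_class a" using C by (auto simp: link_classes_def)
  have h': "inv' h \<in> H" using H.inv_closed h .
  have hh: "h (inv' h x) = x" "inv' h (h x) = x" for x
    using H.bij[OF h] by (simp_all add: bij_is_inj bij_is_surj surj_f_inv_f)
  have "h ` C = link_class (h a)"
  proof
    show "h ` C \<subseteq> link_class (h a)"
      using linked_image[OF h] permutes_in_image[OF H.permutes[OF h]] by (auto simp: a link_class_def)
    show "link_class (h a) \<subseteq> h ` C"
    proof
      fix x assume "x \<in> link_class (h a)"
      then have "inv' h x \<in> C"
        using linked_image[OF h', of "h a" x] permutes_in_image[OF H.permutes[OF h'], of x]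
        by (auto simp: a link_class_def hh)
      then show "x \<in> h ` C" using hh by (metis image_eqI)
    qed
  qed
  then show ?thesis using a permutes_in_image[OF H.permutes[OF h]] by (simp add: link_class_mem)
qed

text \<open>Bochert's argument. Choose \<open>T\<close> of maximal size among the subsets of \<open>R\<close> that support no nontrivial
  element of \<open>H\<close>. If \<open>R - T\<close> were larger than \<open>T\<close>, then it would support a nontrivial \<open>x\<close>, moving \<open>c\<close>
  say, and the set \<open>insert c T\<close> would support a nontrivial \<open>y\<close>, which moves \<open>c\<close> by the choice of \<open>T\<close>.
  The supports of \<open>x\<close> and \<open>y\<close> meet in \<open>c\<close> only, so the commutator is a 3-cycle in \<open>D\<close> that links
  \<open>c\<close> to another point of \<open>R\<close>.\<close>

lemma ex_large_free_set:
  assumes R: "R \<subseteq> \<Omega>" and unlinked: "\<And>a b. a \<in> R \<Longrightarrow> b \<in> R \<Longrightarrow> linked a b \<Longrightarrow> a = b"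
  shows "\<exists>T\<subseteq>R. card R \<le> 2 * card T \<and> (\<forall>h\<in>H. h permutes T \<longrightarrow> h = id)"
proof -
  define free where "free T \<longleftrightarrow> (\<forall>h\<in>H. h permutes T \<longrightarrow> h = id)" for T
  have finR: "finite R" using R finite_points finite_subset by blast
  have "free {}" by (auto simp: free_def)
  define m where "m = Max (card ` {T \<in> Pow R. free T})"
  have fin: "finite (card ` {T \<in> Pow R. free T})" using finR by simp
  moreover have "card ` {T \<in> Pow R. free T} \<noteq> {}" using \<open>free {}\<close> by blast
  ultimately have "m \<in> card ` {T \<in> Pow R. free T}" unfolding m_def by (rule Max_in)
  then obtain T where T: "T \<subseteq> R" "free T" "card T = m" by auto
  have max: "card T' \<le> card T" if "T' \<subseteq> R" "free T'" for T'
    unfolding T(3) m_def using that by (intro Max_ge[OF fin]) auto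
  have finT: "finite T" using T finR finite_subset by blast
  have "card R \<le> 2 * card T"
  proof (rule ccontr)
    assume "\<not> card R \<le> 2 * card T"
    then have "card (R - T) > card T" using T(1) finT by (simp add: card_Diff_subset)
    then have "\<not> free (R - T)" using max[of "R - T"] by auto
    then obtain x where x: "x \<in> H" "x permutes (R - T)" "x \<noteq> id" by (auto simp: free_def)
    then obtain c where c: "x c \<noteq> c" by (auto simp: fun_eq_iff)
    then have cR: "c \<in> R" "c \<notin> T" using x(2) permutes_not_in by fastforce+
    then have "\<not> free (insert c T)" using max[of "insert c T"] T finT by auto
    then obtain y where y: "y \<in> H" "y permutes (insert c T)" "y \<noteq> id" by (auto simp: free_def)
    have yc: "y c \<noteq> c"
    proof
      assume "y c = c"
      then have "y permutes T" using y(2) by (auto intro: permutes_superset)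
      then show False using T(2) y by (auto simp: free_def)
    qed
    have meet: "z = c" if "x z \<noteq> z" "y z \<noteq> z" for z
      using that x(2) y(2) permutes_not_in[of x "R - T" z] permutes_not_in[of y "insert c T" z] by auto
    note comm = commutator_eq_cycle3[OF H.bij[OF x(1)] H.bij[OF y(1)] c yc meet]
    have "has_cycle3 c (x c) (y c)"
      using comm commutator_mem[OF x(1) y(1)] unfolding has_cycle3_def by metis
    then have "linked c (x c)" unfolding linked_def by blast
    moreover have "x c \<in> R" using permutes_in_image[OF x(2), of c] cR by auto
    ultimately show False using unlinked[of c "x c"] cR c by simp
  qed
  then show ?thesis using T by (auto simp: free_def)
qed

end

section \<open>Subgroups of the symmetric group\<close>

text \<open>
  The point set \<open>{1..k}\<close> is a parameter of the locales below, and the simplifier would otherwise rewrite it.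
\<close>

declare One_nat_def [simp del]

lemma perm_group_sym_subgroup:
  assumes "subgroup H (sym_group k)"
  shows "perm_group {1..k} H"
proof -
  interpret H: subgroup H "sym_group k" by fact
  show ?thesis
  proof
    show "d permutes {1..k}" if "d \<in> H" for d
      using H.mem_carrier[OF that] by (simp add: sym_group_carrier)
    show "id \<in> H" using H.one_closed by (simp add: sym_group_one)
    show "d \<circ> e \<in> H" if "d \<in> H" "e \<in> H" for d e
      using H.m_closed[OF that] by (simp add: sym_group_mult)
    show "inv' d \<in> H" if "d \<in> H" for d
      using H.m_inv_closed[OF that] H.mem_carrier[OF that] by simp
  qed simp
qed

locale sym_subgroup =
  fixes k :: nat and H :: "(nat \<Rightarrow> nat) set"
  assumes subgroup_H: "subgroup H (sym_group k)"
begin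

abbreviation "S\<^sub>k \<equiv> sym_group k"
abbreviation "H' \<equiv> derived (sym_group k) H"

interpretation S: group "sym_group k" by (rule sym_group_is_group)

interpretation H: subgroup H "sym_group k" by (rule subgroup_H)

lemma subgroup_derived: "subgroup H' (sym_group k)"
  using S.derived_is_subgroup[OF H.subset] .

interpretation H': subgroup H' "sym_group k" by (rule subgroup_derived)

lemma derived_subset: "H' \<subseteq> H"
  using S.derived_incl[OF order_refl subgroup_H] .

sublocale perm_group_commutators "{1..k}" H' H
proof (intro perm_group_commutators.intro perm_group_commutators_axioms.intro)
  show "perm_group {1..k} H'" using subgroup_derived by (rule perm_group_sym_subgroup)
  show "perm_group {1..k} H" using subgroup_H by (rule perm_group_sym_subgroup)
  show "H' \<subseteq> H" by (rule derived_subset)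
  fix x y assume xy: "x \<in> H" "y \<in> H"
  then have "x \<otimes>\<^bsub>S\<^sub>k\<^esub> y \<otimes>\<^bsub>S\<^sub>k\<^esub> inv\<^bsub>S\<^sub>k\<^esub> x \<otimes>\<^bsub>S\<^sub>k\<^esub> inv\<^bsub>S\<^sub>k\<^esub> y \<in> H'"
    unfolding derived_def by (intro generate.incl) blast
  then show "x \<circ> y \<circ> inv' x \<circ> inv' y \<in> H'"
    using xy H.mem_carrier by (simp add: sym_group_mult)
qed

lemma finite_H: "finite H"
  using perm_group.permutes[OF perm_group_sym_subgroup[OF subgroup_H]]
  by (auto intro: finite_subset[OF _ finite_permutations[of "{1..k}"]])

lemma rcoset_comp:
  assumes "subgroup L (sym_group k)" "d \<in> L" "g permutes {1..k}"
  shows "L #>\<^bsub>S\<^sub>k\<^esub> (d \<circ> g) = L #>\<^bsub>S\<^sub>k\<^esub> g"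
proof -
  interpret L: subgroup L "sym_group k" by fact
  show ?thesis
    using S.coset_mult_assoc[OF L.subset, of d g] L.rcos_const[OF S.is_group assms(2)]
      L.mem_carrier[OF assms(2)] assms(3)
    by (simp add: sym_group_carrier sym_group_mult)
qed

lemma order_abelianization:
  "order (abelianization (sym_group k) H) = card ((\<lambda>g. H' #>\<^bsub>S\<^sub>k\<^esub> g) ` H)"
  by (simp add: abelianization_def order_def carrier_FactGroup S.derived_consistent[OF order_refl subgroup_H])

text \<open>One factor \<open>2 ^ card link_classes\<close> comes from the action of \<open>H\<close> on its link classes. The other
  bounds the image of the kernel of this action: modulo the commutator subgroup, each element of it
  agrees with one that moves marked points only.\<close>

theorem order_abelianization_le:
  "order (abelianization (sym_group k) H) \<le> 4 ^ card link_classes"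
proof -
  define f where "f = (\<lambda>g. H' #>\<^bsub>S\<^sub>k\<^esub> g)"
  let ?G = "sym_group k\<lparr>carrier := H\<rparr>"
  let ?A = "?G Mod derived ?G H"
  interpret G: group ?G by (rule S.subgroup_imp_group[OF subgroup_H])
  have derived_eq: "derived ?G H = H'" by (rule S.derived_consistent[OF order_refl subgroup_H])
  have A: "comm_group ?A" using G.derived_quot_is_comm_group by simp
  interpret N: normal "derived ?G H" ?G using G.derived_self_is_normal by simp
  have f: "f \<in> hom ?G ?A"
    using N.r_coset_hom_Mod by (simp add: f_def derived_eq)
  interpret abelian_image_action ?G ?A f "(`)"
  proof (intro abelian_image_action.intro group_hom.intro group_hom_axioms.intro
      abelian_image_action_axioms.intro G.is_group A f)
    show "group ?A" using A by (rule comm_group.axioms(2))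
  qed (auto simp: sym_group_def finite_H image_comp)
  have "card (f ` H) \<le> 2 ^ card link_classes * card (f ` fixer H link_classes)"
  proof (rule card_image_le_fixer)
    show "subgroup H ?G" using G.subgroup_self by simp
  qed (use image_link_class finite_link_classes in auto)
  moreover have "card (f ` fixer H link_classes) \<le> 2 ^ card link_classes"
  proof -
    obtain p q where pq: "two_points p q" using ex_two_points by blast
    have "f ` fixer H link_classes \<subseteq> f ` marked_permutations p q"
    proof
      fix c assume "c \<in> f ` fixer H link_classes"
      then obtain g where g: "g \<in> H" "\<And>C. C \<in> link_classes \<Longrightarrow> g ` C = C" "c = f g"
        by (auto simp: fixer_def)
      have perm: "g permutes {1..k}" using H.mem_carrier[OF g(1)] by (simp add: sym_group_carrier)
      have "linked x (g x)" if x: "x \<in> {1..k}" for x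
      proof -
        have "g x \<in> link_class x" using g(2)[OF link_class_mem[OF x]] link_class_self[OF x] by blast
        then show ?thesis by (simp add: link_class_def)
      qed
      then have "g \<in> class_permutations" using perm by (auto simp: class_permutations_def)
      from reduce_to_marked[OF pq this] obtain d where d: "d \<in> H'" "d \<circ> g \<in> marked_permutations p q"
        by (auto simp: marked_permutations_def)
      have "c = f (d \<circ> g)" using rcoset_comp[OF subgroup_derived d(1) perm] g(3) by (simp add: f_def)
      then show "c \<in> f ` marked_permutations p q" using d(2) by blast
    qed
    then have "card (f ` fixer H link_classes) \<le> card (f ` marked_permutations p q)"
      using card_marked_permutations[OF pq] by (intro card_mono) auto
    also have "\<dots> \<le> card (marked_permutations p q)"
      using card_marked_permutations[OF pq] by (intro card_image_le) auto
    also have "\<dots> \<le> 2 ^ card link_classes" using card_marked_permutations[OF pq] by auto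
    finally show ?thesis .
  qed
  ultimately have "card (f ` H) \<le> 2 ^ card link_classes * 2 ^ card link_classes"
    by (meson le_trans mult_le_mono2)
  also have "\<dots> = 4 ^ card link_classes" by (simp flip: power_mult_distrib)
  finally show ?thesis by (simp add: order_abelianization f_def)
qed

lemma finite_rcosets: "finite (rcosets\<^bsub>S\<^sub>k\<^esub> H)"
  using finite_permutations[of "{1..k}"] by (simp add: RCOSETS_def sym_group_def)

lemma rcoset_mem: "g permutes {1..k} \<Longrightarrow> H #>\<^bsub>S\<^sub>k\<^esub> g \<in> rcosets\<^bsub>S\<^sub>k\<^esub> H"
  using S.rcosetsI[OF H.subset] by (simp add: sym_group_carrier)

lemma rcoset_eqE:
  assumes "H #>\<^bsub>S\<^sub>k\<^esub> g = H #>\<^bsub>S\<^sub>k\<^esub> g'" "g permutes {1..k}"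
  obtains h where "h \<in> H" "g = h \<circ> g'"
proof -
  have "g \<in> H #>\<^bsub>S\<^sub>k\<^esub> g"
    using S.rcos_self[OF _ subgroup_H] assms(2) by (simp add: sym_group_carrier)
  then show ?thesis using that unfolding assms(1) by (auto simp: r_coset_def sym_group_mult)
qed

lemma group_index_le_fact: "group_index (sym_group k) H \<le> fact k"
proof -
  have "group_index (sym_group k) H \<le> card (carrier (sym_group k))"
    unfolding group_index_def RCOSETS_def using finite_permutations[of "{1..k}"]
    by (simp add: sym_group_def UNION_singleton_eq_range card_image_le)
  then show ?thesis by (simp add: sym_group_def card_permutations)
qed

lemma order_abelianization_le_fact: "order (abelianization (sym_group k) H) \<le> fact k"
proof -
  have "order (abelianization (sym_group k) H) \<le> card H"
    unfolding order_abelianization by (intro card_image_le finite_H)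
  also have "\<dots> \<le> card (carrier (sym_group k))"
    using H.subset finite_permutations[of "{1..k}"] by (intro card_mono) (auto simp: sym_group_def)
  finally show ?thesis by (simp add: sym_group_def card_permutations)
qed

text \<open>With a single class, every permutation of the points preserves the classes. The straightening
  by 3-cycles from the commutator subgroup then applies to all of \<open>Sym(k)\<close>, and it leaves at most two
  coset representatives.\<close>

lemma group_index_le_if_one_class:
  assumes "card link_classes \<le> 1"
  shows "group_index (sym_group k) H \<le> 2"
proof -
  obtain p q where pq: "two_points p q" using ex_two_points by blast
  have linked_all: "linked x y" if "x \<in> {1..k}" "y \<in> {1..k}" for x y
  proof -
    have "link_class x = link_class y"
      using assms finite_link_classes link_class_mem that by (metis card_le_Suc0_iff_eq One_nat_def)
    then have "y \<in> link_class x" using link_class_self[OF that(2)] by simp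
    then show ?thesis by (simp add: link_class_def)
  qed
  have "rcosets\<^bsub>S\<^sub>k\<^esub> H \<subseteq> (\<lambda>g. H #>\<^bsub>S\<^sub>k\<^esub> g) ` marked_permutations p q"
  proof
    fix c assume "c \<in> rcosets\<^bsub>S\<^sub>k\<^esub> H"
    then obtain g where g: "g permutes {1..k}" "c = H #>\<^bsub>S\<^sub>k\<^esub> g"
      by (auto simp: RCOSETS_def sym_group_carrier)
    have "g \<in> class_permutations"
      using g(1) linked_all permutes_in_image[OF g(1)] by (auto simp: class_permutations_def)
    from reduce_to_marked[OF pq this] obtain d where d: "d \<in> H'" "d \<circ> g \<in> marked_permutations p q"
      by (auto simp: marked_permutations_def)
    have "c = H #>\<^bsub>S\<^sub>k\<^esub> (d \<circ> g)"
      using rcoset_comp[OF subgroup_H _ g(1)] d(1) derived_subset g(2) by blast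
    then show "c \<in> (\<lambda>g. H #>\<^bsub>S\<^sub>k\<^esub> g) ` marked_permutations p q" using d(2) by blast
  qed
  then have "group_index (sym_group k) H \<le> card (marked_permutations p q)"
    unfolding group_index_def using card_marked_permutations(2)[OF pq] surj_card_le by blast
  also have "\<dots> \<le> 2 ^ card link_classes" by (rule card_marked_permutations(1)[OF pq])
  also have "\<dots> \<le> 2 ^ 1" using assms by (intro power_increasing) auto
  finally show ?thesis by simp
qed

text \<open>Distinct permutations of a set \<open>T\<close> that supports no nontrivial element of \<open>H\<close> represent distinct
  cosets. A transversal of the classes contains such a set of at least half its size.\<close>

lemma ex_fact_le_group_index:
  obtains t where "card link_classes \<le> 2 * t" "fact t \<le> group_index (sym_group k) H"
proof -
  obtain p q where pq: "two_points p q" using ex_two_points by blast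
  define R where "R = p ` link_classes"
  have p: "p C \<in> C" "p C \<in> {1..k}" "link_class (p C) = C" if "C \<in> link_classes" for C
  proof -
    show "p C \<in> C" using pq that by (simp add: two_points_def)
    from link_class_eq[OF that this] show "p C \<in> {1..k}" "link_class (p C) = C" by auto
  qed
  have inj: "inj_on p link_classes" using p(3) by (metis inj_onI)
  have "\<exists>T\<subseteq>R. card R \<le> 2 * card T \<and> (\<forall>h\<in>H. h permutes T \<longrightarrow> h = id)"
  proof (rule ex_large_free_set)
    show "R \<subseteq> {1..k}" using p by (auto simp: R_def)
    fix a b assume "a \<in> R" "b \<in> R" "linked a b"
    then obtain A B where AB: "A \<in> link_classes" "B \<in> link_classes" "a = p A" "b = p B"
      by (auto simp: R_def)
    then have "b \<in> A" using mem_link_class_iff[OF AB(1), of a b] p \<open>linked a b\<close> by auto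
    then have "A = link_class b" by (rule link_class_eq(1)[OF AB(1)])
    then show "a = b" using AB p(3) by simp
  qed
  then obtain T where T: "T \<subseteq> R" "card R \<le> 2 * card T" "\<And>h. h \<in> H \<Longrightarrow> h permutes T \<Longrightarrow> h = id"
    by blast
  have sub: "T \<subseteq> {1..k}" using T(1) p by (auto simp: R_def)
  have finT: "finite T" using sub finite_subset by blast
  have "inj_on (\<lambda>g. H #>\<^bsub>S\<^sub>k\<^esub> g) {g. g permutes T}"
  proof (rule inj_onI, clarsimp)
    fix g g' assume g: "g permutes T" "g' permutes T" and eq: "H #>\<^bsub>S\<^sub>k\<^esub> g = H #>\<^bsub>S\<^sub>k\<^esub> g'"
    obtain h where h: "h \<in> H" "g = h \<circ> g'" using rcoset_eqE[OF eq permutes_subset[OF g(1) sub]] .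
    then have "h = g \<circ> inv' g'" using permutes_inv_o[OF g(2)] by (simp add: comp_assoc)
    then have "h permutes T" using permutes_compose[OF permutes_inv[OF g(2)] g(1)] by simp
    then show "g = g'" using T(3)[OF h(1)] h(2) by simp
  qed
  moreover have "(\<lambda>g. H #>\<^bsub>S\<^sub>k\<^esub> g) ` {g. g permutes T} \<subseteq> rcosets\<^bsub>S\<^sub>k\<^esub> H"
    using rcoset_mem permutes_subset[OF _ sub] by blast
  ultimately have "card {g. g permutes T} \<le> group_index (sym_group k) H"
    unfolding group_index_def using card_inj_on_le finite_rcosets by blast
  then have "fact (card T) \<le> group_index (sym_group k) H"
    using card_permutations[OF refl finT] by simp
  moreover have "card link_classes \<le> 2 * card T" using T(2) card_image[OF inj] by (simp add: R_def)
  ultimately show ?thesis using that by blast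
qed

text \<open>A set \<open>B\<close> with as many points as \<open>C\<close> is the preimage of \<open>C\<close> under some permutation \<open>g\<close>. Replacing \<open>g\<close>
  by the representative of its coset changes \<open>C\<close> to another class, because \<open>H\<close> permutes the classes.
  Hence \<open>B\<close> is determined by a coset and a class.\<close>

lemma binomial_le_group_index:
  assumes C: "C \<in> link_classes"
  shows "k choose card C \<le> group_index (sym_group k) H * card link_classes"
proof -
  define rep where "rep c = (SOME g. g permutes {1..k} \<and> H #>\<^bsub>S\<^sub>k\<^esub> g = c)" for c
  have sub: "C \<subseteq> {1..k}" using link_class_eq(2)[OF C] by blast
  have "{B. B \<subseteq> {1..k} \<and> card B = card C} \<subseteq>
      (\<lambda>(c, E). inv' (rep c) ` E) ` ((rcosets\<^bsub>S\<^sub>k\<^esub> H) \<times> link_classes)"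
  proof clarify
    fix B assume B: "B \<subseteq> {1..k}" "card B = card C"
    \<comment> \<open>A permutation that maps \<open>B\<close> to \<open>C\<close> is glued from bijections between these sets and between their complements.\<close>
    have "finite B" "finite C" using finite_subset[OF B(1)] finite_subset[OF sub] by simp_all
    then obtain g1 where g1: "bij_betw g1 B C" using finite_same_card_bij[of B C] B(2) by blast
    have "card ({1..k} - B) = card ({1..k} - C)"
      using B sub \<open>finite B\<close> \<open>finite C\<close> by (simp add: card_Diff_subset)
    then obtain g2 where g2: "bij_betw g2 ({1..k} - B) ({1..k} - C)"
      using finite_same_card_bij[of "{1..k} - B" "{1..k} - C"] by auto
    define g where "g x = (if x \<in> B then g1 x else if x \<in> {1..k} then g2 x else x)" for x
    have "bij_betw (\<lambda>x. if x \<in> B then g1 x else g2 x) (B \<union> ({1..k} - B)) (C \<union> ({1..k} - C))"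
      by (intro bij_betw_disjoint_Un g1 g2) auto
    then have "bij_betw (\<lambda>x. if x \<in> B then g1 x else g2 x) {1..k} {1..k}"
      using B(1) sub by (simp add: Un_absorb1)
    then have "bij_betw g {1..k} {1..k}"
      using bij_betw_cong[of "{1..k}" g "\<lambda>x. if x \<in> B then g1 x else g2 x" "{1..k}"]
      by (simp add: g_def)
    then have g_permutes: "g permutes {1..k}" using B(1) by (intro bij_imp_permutes) (auto simp: g_def)
    have "g ` B = C" using g1 by (auto simp: g_def bij_betw_def)
    note g = g_permutes this
    define c where "c = H #>\<^bsub>S\<^sub>k\<^esub> g"
    have "rep c permutes {1..k} \<and> H #>\<^bsub>S\<^sub>k\<^esub> rep c = c"
      unfolding rep_def by (rule someI[of _ g]) (simp add: c_def g)
    then have rep: "rep c permutes {1..k}" "H #>\<^bsub>S\<^sub>k\<^esub> rep c = H #>\<^bsub>S\<^sub>k\<^esub> g" by (auto simp: c_def)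
    obtain h where h: "h \<in> H" "rep c = h \<circ> g" using rcoset_eqE[OF rep(2,1)] .
    have "rep c ` B = h ` C" unfolding h(2) image_comp[symmetric] g(2) ..
    then have "B = inv' (rep c) ` (h ` C)"
      using image_inv_f_f[OF permutes_inj[OF rep(1)], of B] by simp
    moreover have "c \<in> rcosets\<^bsub>S\<^sub>k\<^esub> H" using rcoset_mem[OF g(1)] by (simp add: c_def)
    moreover have "h ` C \<in> link_classes" using image_link_class[OF h(1) C] .
    ultimately show "B \<in> (\<lambda>(c, E). inv' (rep c) ` E) ` ((rcosets\<^bsub>S\<^sub>k\<^esub> H) \<times> link_classes)" by force
  qed
  then have "card {B. B \<subseteq> {1..k} \<and> card B = card C} \<le> card ((rcosets\<^bsub>S\<^sub>k\<^esub> H) \<times> link_classes)"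
    by (rule surj_card_le[rotated]) (intro finite_cartesian_product finite_rcosets finite_link_classes)
  then show ?thesis by (simp add: n_subsets card_cartesian_product group_index_def)
qed

text \<open>A class of maximal size is at least as large as the average one. Each of the other classes contains
  a point, which bounds the size of the largest one from above.\<close>

lemma ex_large_class:
  assumes "k \<ge> 1"
  obtains C where "C \<in> link_classes" "k \<le> card link_classes * card C"
    "card C + card link_classes \<le> k + 1"
proof -
  define s where "s = Max (card ` link_classes)"
  have ne: "link_classes \<noteq> {}" using assms by (auto simp: link_classes_def)
  have fin: "finite (card ` link_classes)" using finite_link_classes by simp
  have "s \<in> card ` link_classes" unfolding s_def using fin ne by (intro Max_in) auto
  then obtain C where C: "C \<in> link_classes" "card C = s" by auto
  have Un: "\<Union> link_classes = {1..k}"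
    using link_class_self by (auto simp: link_classes_def) (auto simp: link_class_def)
  have finC: "finite E" if "E \<in> link_classes" for E
    using that Un finite_subset[of E "{1..k}"] by blast
  have disj: "pairwise disjnt link_classes"
    using link_class_eq(1) by (metis disjnt_iff pairwiseI)
  have sum: "sum card link_classes = k"
    using card_Union_disjoint[OF disj finC] by (simp add: Un)
  have "sum card link_classes \<le> card link_classes * s"
    using fin sum_bounded_above[of link_classes card s] by (simp add: s_def)
  moreover have "card E \<ge> 1" if E: "E \<in> link_classes" for E
  proof -
    obtain a where "a \<in> {1..k}" "E = link_class a" using E by (auto simp: link_classes_def)
    then have "E \<noteq> {}" using link_class_self by blast
    then show ?thesis using finC[OF E] card_gt_0_iff[of E] by linarith
  qed
  then have "(\<Sum>E\<in>link_classes - {C}. 1) \<le> sum card (link_classes - {C})"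
    by (intro sum_mono) blast
  then have "card link_classes - 1 + card C \<le> sum card link_classes"
    using C(1) finite_link_classes sum.remove[OF finite_link_classes C(1), of card] by simp
  moreover have "card link_classes \<ge> 1"
    using ne finite_link_classes card_gt_0_iff[of link_classes] by linarith
  ultimately show ?thesis using that[OF C(1)] C(2) sum by auto
qed

end

section \<open>Numerical estimates\<close>

lemma power_le_fact: "(real t / 3) ^ t \<le> fact t"
proof (induction t)
  case (Suc t)
  have step: "real (Suc t) ^ t \<le> 3 * real t ^ t"
  proof (cases "t = 0")
    case False
    have "real (Suc t) ^ t = (1 + 1 / real t) ^ t * real t ^ t"
      using False by (simp add: field_simps flip: power_mult_distrib)
    also have "(1 + 1 / real t) ^ t \<le> exp 1"
      using exp_ge_one_plus_x_over_n_power_n[of t 1] False by simp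
    also have "exp 1 \<le> (3::real)" by (rule exp_le)
    finally show ?thesis by (simp add: mult_right_mono)
  qed simp
  have "(real (Suc t) / 3) ^ Suc t = real (Suc t) * (real (Suc t) ^ t / 3) / 3 ^ t"
    by (simp add: power_divide)
  also have "\<dots> \<le> real (Suc t) * real t ^ t / 3 ^ t"
    using step by (intro divide_right_mono mult_left_mono) auto
  also have "\<dots> = real (Suc t) * (real t / 3) ^ t" by (simp add: power_divide)
  also have "\<dots> \<le> real (Suc t) * fact t" by (intro mult_left_mono Suc.IH) simp
  finally show ?case by simp
qed simp

text \<open>With \<open>q\<close> the fourth root of \<open>k\<close>, it is enough to bound \<open>n\<close> below by \<open>q ^ e\<close> for some \<open>e \<ge> m / 4\<close>. If
  \<open>m ^ 2 \<le> k\<close>, then \<open>c \<ge> m\<close>, and the binomial coefficient is at least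
  \<open>(k / (m - 1)) ^ (m - 1) \<ge> (q ^ 2) ^ (m - 1)\<close>; one half of each factor \<open>q ^ 2 \<ge> 2 * q\<close> absorbs the factor
  \<open>m \<le> 2 ^ (m - 1)\<close>. If \<open>m ^ 2 > k\<close>, then \<open>t \<ge> q ^ 2 / 2\<close>, and the factorial is at least
  \<open>(t / 3) ^ t \<ge> (q ^ 2 / 6) ^ t \<ge> q ^ t\<close>. The last step uses \<open>q \<ge> 6\<close>, which is where
  \<open>1296 = 6 ^ 4\<close> comes from.\<close>

lemma powr_le_index:
  fixes k m c t n :: nat
  assumes "k \<ge> 1296" "m \<ge> 2"
    and c: "k \<le> m * c" "c + m \<le> k + 1" "k choose c \<le> n * m"
    and t: "m \<le> 2 * t" "fact t \<le> n"
  shows "real k powr (real m / 16) \<le> real n"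
proof -
  define q where "q = real k powr (1/4)"
  have "(6::real) = 1296 powr (1/4)"
    using powr_powr[of 6 4 "1/4 :: real"] by simp
  also have "\<dots> \<le> q" unfolding q_def using assms(1) by (intro powr_mono2) auto
  finally have q6: "q \<ge> 6" .
  have q4: "real k = q ^ 4"
    using assms(1) by (simp add: q_def powr_powr flip: powr_realpow)
  have goal: "real k powr (real m / 16) \<le> q ^ e" if "m \<le> 4 * e" for e
  proof -
    have "real k powr (real m / 16) = q powr (real m / 4)" by (simp add: q_def powr_powr)
    also have "\<dots> \<le> q powr (real e)" using that q6 by (intro powr_mono) auto
    also have "\<dots> = q ^ e" using q6 by (simp add: powr_realpow)
    finally show ?thesis .
  qed
  show ?thesis
  proof (cases "m ^ 2 \<le> k")
    case True
    define e where "e = m - 1"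
    have e: "m = e + 1" "e \<ge> 1" using assms(2) by (auto simp: e_def)
    have "m * m \<le> m * c" using True c(1) by (simp only: power2_eq_square)
    then have "m \<le> c" using assms(2) c(1) by (metis mult_le_cancel1 le_trans not_numeral_le_zero neq0_conv)
    have "k choose e \<le> k choose c"
    proof (cases "2 * c \<le> k")
      case True
      then show ?thesis using \<open>m \<le> c\<close> e by (intro binomial_mono) auto
    next
      case False
      have "k choose e \<le> k choose (k - c)" using False c(2) e by (intro binomial_mono) auto
      also have "\<dots> = k choose c" using c(2) e by (intro binomial_symmetric[symmetric]) auto
      finally show ?thesis .
    qed
    then have "real (k choose e) \<le> real (n * m)" using c(3) by (intro of_nat_mono) simp
    moreover have "(real k / real e) ^ e \<le> real (k choose e)"
      using c(2) e by (intro binomial_ge_n_over_k_pow_k) auto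
    moreover have "(q * 2) ^ e \<le> (real k / real e) ^ e"
    proof (intro power_mono)
      have "real e ^ 2 \<le> real (m ^ 2)" using e by (simp add: power_mono)
      also have "\<dots> \<le> real k" using True by (intro of_nat_mono)
      also have "\<dots> = (q ^ 2) ^ 2" by (simp add: q4)
      finally have "real e \<le> q ^ 2" by (rule power2_le_imp_le) simp
      then have "q ^ 2 * real e \<le> real k" 
        using mult_left_mono[of "real e" "q ^ 2" "q ^ 2"] by (simp add: q4 power4_eq_xxxx power2_eq_square)
      moreover have "q * 2 \<le> q ^ 2" using q6 by (simp add: power2_eq_square)
      ultimately have "(q * 2) * real e \<le> real k" 
        using mult_right_mono[of "q * 2" "q ^ 2" "real e"] by linarith
      then show "q * 2 \<le> real k / real e" using e by (simp add: field_simps)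
    qed (use q6 in auto)
    moreover have "real m \<le> 2 ^ e"
    proof -
      have "e + 1 \<le> 2 ^ e" by (induction e) auto
      then show ?thesis unfolding e(1) by (metis of_nat_le_iff of_nat_numeral of_nat_power)
    qed
    then have "real (n * m) \<le> real n * 2 ^ e" by (simp add: mult_left_mono)
    ultimately have "(q * 2) ^ e \<le> real n * 2 ^ e" by linarith
    then have "q ^ e \<le> real n" by (simp add: power_mult_distrib)
    moreover have "m \<le> 4 * e" using e by simp
    ultimately show ?thesis using goal[of e] by linarith
  next
    case False
    then have "real k \<le> real (m ^ 2)" by (intro of_nat_mono) simp
    then have "(q ^ 2) ^ 2 \<le> real m ^ 2" by (simp add: q4)
    then have "q ^ 2 \<le> real m" by (rule power2_le_imp_le) simp
    also have "\<dots> \<le> 2 * real t" using t(1) by (metis of_nat_le_iff of_nat_mult of_nat_numeral)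
    finally have "q * q \<le> 2 * real t" by (simp add: power2_eq_square)
    moreover have "q * 6 \<le> q * q" using q6 by (intro mult_left_mono) auto
    ultimately have "q \<le> real t / 3" by linarith
    then have "q ^ t \<le> (real t / 3) ^ t" using q6 by (intro power_mono) auto
    also have "\<dots> \<le> fact t" by (rule power_le_fact)
    also have "\<dots> \<le> real n" using t(2) by (metis of_nat_fact of_nat_le_iff)
    finally show ?thesis using goal[of t] t(1) by linarith
  qed
qed

lemma le_powr_of_log_le:
  fixes a l n N :: real
  assumes "N > 0" "n > 0" "log 2 N \<le> a / l * log 2 n"
  shows "N \<le> n powr (a / l)"
proof -
  have "N = 2 powr (log 2 N)" using assms by simp
  also have "\<dots> \<le> 2 powr (a / l * log 2 n)" using assms(3) by (intro powr_mono) auto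
  also have "\<dots> = (2 powr log 2 n) powr (a / l)" by (simp add: powr_powr mult.commute)
  also have "\<dots> = n powr (a / l)" using assms by simp
  finally show ?thesis .
qed

lemma log_le_of_nat: "log 2 (real k) \<le> real k"
proof (cases "k = 0")
  case False
  have "k \<le> 2 ^ k" using less_exp[of k] by simp
  then show ?thesis using False by (intro log2_of_power_le) auto
qed (simp add: log_def)

lemma log_log_index_le:
  fixes k n :: nat
  assumes "3 \<le> n" "n \<le> fact k"
  shows "log 2 n > 1" and "log 2 (log 2 n) > 0"
    and "log 2 (log 2 n) \<le> log 2 n" and "log 2 (log 2 n) \<le> 2 * log 2 k"
proof -
  have "log 2 2 < log 2 (real n)" using assms(1) by (subst log_less_cancel_iff) auto
  then show L: "log 2 n > 1" by simp
  then show "log 2 (log 2 n) > 0" by simp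
  show "log 2 (log 2 n) \<le> log 2 n"
    using log_le_of_nat[of n] L assms(1) by (subst log_le_cancel_iff) auto
  have k: "k > 0" using assms by (intro Nat.gr0I) simp
  have "n \<le> k ^ k" using assms(2) fact_le_power[of k, where 'a = nat] by simp
  then have "real n \<le> real k ^ k" by (metis of_nat_le_iff of_nat_power)
  then have "log 2 n \<le> log 2 (real k ^ k)" using assms(1) k by (subst log_le_cancel_iff) auto
  also have "\<dots> = k * log 2 k" using k by (simp add: log_nat_power)
  also have "\<dots> \<le> real k * real k" using log_le_of_nat[of k] by (intro mult_left_mono) auto
  finally have "log 2 (log 2 n) \<le> log 2 (real k ^ 2)"
    using L k by (subst log_le_cancel_iff) (auto simp: power2_eq_square)
  then show "log 2 (log 2 n) \<le> 2 * log 2 k" using k by (simp add: log_nat_power)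
qed

section \<open>Abelianizations of permutation groups\<close>

theorem theorem1p1:
  shows "\<exists>\<alpha>::real. \<alpha> > 0 \<and>
    (\<forall>k::nat. \<forall>H. k \<ge> 1 \<longrightarrow> subgroup H (sym_group k) \<longrightarrow>
      group_index (sym_group k) H \<ge> 3 \<longrightarrow>
      real (order (abelianization (sym_group k) H)) \<le>
        real (group_index (sym_group k) H) powr
          (\<alpha> / log 2 (log 2 (real (group_index (sym_group k) H)))))"
proof -
  \<comment> \<open>The constant is kept abstract so that the factorial of 1296 is never computed.\<close>
  define K :: nat where "K = 1296"
  define \<alpha> where "\<alpha> = max 64 (log 2 (fact K))"
  have \<alpha>: "\<alpha> \<ge> 64" "\<alpha> \<ge> log 2 (fact K)" by (simp_all add: \<alpha>_def)
  have "real (order (abelianization (sym_group k) H)) \<le> real (group_index (sym_group k) H) powr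
          (\<alpha> / log 2 (log 2 (real (group_index (sym_group k) H))))"
    if k: "k \<ge> 1" and H: "subgroup H (sym_group k)" and index: "group_index (sym_group k) H \<ge> 3"
    for k :: nat and H
  proof -
    interpret sym_subgroup k H using H by (rule sym_subgroup.intro)
    define n where "n = group_index (sym_group k) H"
    define N where "N = order (abelianization (sym_group k) H)"
    define m where "m = card link_classes"
    define l where "l = log 2 (log 2 (real n))"
    note n = index[folded n_def]
    have l: "log 2 n > 1" "l > 0" "l \<le> log 2 n" "l \<le> 2 * log 2 k"
      unfolding l_def using log_log_index_le[OF n group_index_le_fact[folded n_def]] by auto
    have N0: "N > 0"
    proof -
      have "\<one>\<^bsub>sym_group k\<^esub> \<in> H" by (rule subgroup.one_closed[OF H])
      then show ?thesis
        using finite_H by (auto simp: N_def order_abelianization card_gt_0_iff)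
    qed
    have "log 2 N \<le> \<alpha> / l * log 2 n"
    \<comment> \<open>For small \<open>k\<close> the order of \<open>H\<close> is bounded, and the exponent is at least \<open>\<alpha> / log n\<close>.\<close>
    proof (cases "k \<le> K")
      case True
      have "real N \<le> fact K"
        using order_abelianization_le_fact fact_mono[OF True, where 'a = nat]
        unfolding N_def by (metis le_trans of_nat_fact of_nat_le_iff)
      then have "log 2 N \<le> log 2 (fact K)" using N0 by (subst log_le_cancel_iff) auto
      also have "\<dots> \<le> \<alpha> * 1" using \<alpha> by simp
      also have "\<dots> \<le> \<alpha> * (log 2 n / l)" using \<alpha> l by (intro mult_left_mono) auto
      finally show ?thesis by simp
    next
      case False
      have m: "m \<ge> 2"
        using group_index_le_if_one_class index unfolding m_def by linarith
      obtain C where C: "C \<in> link_classes" "k \<le> m * card C" "card C + m \<le> k + 1"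
        using ex_large_class[OF k] unfolding m_def by blast
      obtain t where t: "m \<le> 2 * t" "fact t \<le> n"
        using ex_fact_le_group_index unfolding m_def n_def by blast
      have "k \<ge> 1296" using False by (simp add: K_def)
      then have "real k powr (real m / 16) \<le> real n"
        using powr_le_index m C(2,3) binomial_le_group_index[OF C(1), folded m_def n_def] t by blast
      then have "log 2 (real k powr (real m / 16)) \<le> log 2 n"
        using k n by (subst log_le_cancel_iff) auto
      then have index_large: "m / 16 * log 2 k \<le> log 2 n" using k by (simp add: log_powr)
      have "real N \<le> 2 ^ (2 * m)"
        using order_abelianization_le[folded m_def N_def]
        by (simp add: power_mult)
      then have "log 2 N \<le> log 2 (2 ^ (2 * m))" using N0 by (subst log_le_cancel_iff) auto
      also have "\<dots> = 2 * m" by (simp add: log_nat_power)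
      finally have "log 2 N * l \<le> 2 * m * (2 * log 2 k)"
        using l by (intro mult_mono) auto
      also have "\<dots> = 64 * (m / 16 * log 2 k)" by simp
      also have "\<dots> \<le> \<alpha> * log 2 n" using \<alpha> l index_large k by (intro mult_mono) auto
      finally show ?thesis using l(2) by (simp add: field_simps)
    qed
    then show ?thesis
      using le_powr_of_log_le[of N n \<alpha> l] N0 n unfolding n_def N_def l_def by simp
  qed
  then show ?thesis using \<alpha>(1) by (intro exI[of _ \<alpha>]) auto
qed

end
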